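(* Let $\mathfrak{H}$ be a real or complex Hilbert space and let $A:\mathfrak{H}\to\mathfrak{H}$ be a symmetric linear operator whose domain $\operatorname{dom} A$ is not assumed to be dense in $\mathfrak{H}$. The following assertions are equivalent: (i) $A$ is a densely defined and selfadjoint operator; (ii) $A^2$ is a positive selfadjoint operator; (iii) $I+A^2$ is a full range operator, i.e. $\operatorname{ran}(I+A^2)=\mathfrak{H}$.
   Context: Operators are linear, possibly unbounded, and $A:\mathfrak{H}\to\mathfrak{H}$ means that $A$ is defined on a linear subspace $\operatorname{dom} A\subseteq\mathfrak{H}$ with values in $\mathfrak{H}$; neither density of the domain nor closedness is assumed. $A$ is symmetric if $(Ax\,|\,y)=(x\,|\,Ay)$ for all $x,y\in\operatorname{dom} A$. A densely defined operator $B$ is selfadjoint if $B=B^*$ (equality of domains included); in particular, selfadjointness includes being densely defined. A symmetric operator $B$ is positive if $(Bx\,|\,x)\geq 0$ for all $x\in\operatorname{dom} B$. $A^2$ has its natural domain $\operatorname{dom} A^2=\{x\in\operatorname{dom} A : Ax\in\operatorname{dom} A\}$, $I$ is the identity operator, $\operatorname{dom}(I+A^2)=\operatorname{dom} A^2$, and $\operatorname{ran}$ denotes the range. *)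

theory Defs
  imports "HOL-Analysis.Analysis"
begin

text \<open>
  Real Hilbert spaces are the types of sort \<open>{real_inner, complete_space}\<close>. The library has no
  complex counterpart, so the class below adds complex scalars and a sesquilinear form, linear in
  its first argument, to the underlying real space. As \<open>inner\<close> is the real part of \<open>cinner\<close>, the
  norm and the topology are those of \<open>cinner\<close> (see \<open>norm_eq_sqrt_cinner\<close>).
\<close>

class complex_inner = real_inner +
  fixes scaleC :: "complex \<Rightarrow> 'a \<Rightarrow> 'a"
    and cinner :: "'a \<Rightarrow> 'a \<Rightarrow> complex"
  assumes scaleC_add_right: "scaleC a (x + y) = scaleC a x + scaleC a y"
    and scaleC_add_left: "scaleC (a + b) x = scaleC a x + scaleC b x"
    and scaleC_scaleC: "scaleC a (scaleC b x) = scaleC (a * b) x"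
    and scaleC_one: "scaleC 1 x = x"
    and scaleR_scaleC: "scaleR r x = scaleC (complex_of_real r) x"
    and cinner_commute: "cinner x y = cnj (cinner y x)"
    and cinner_add_left: "cinner (x + y) z = cinner x z + cinner y z"
    and cinner_scaleC_left: "cinner (scaleC a x) y = a * cinner x y"
    and inner_eq_Re_cinner: "inner x y = Re (cinner x y)"

lemma cinner_self:
  fixes x :: "'a::complex_inner"
  shows "cinner x x = complex_of_real (inner x x)"
proof -
  have "Im (cinner x x) = - Im (cinner x x)"
    by (subst cinner_commute) simp
  then show ?thesis
    by (simp add: complex_eq_iff inner_eq_Re_cinner)
qed

lemma norm_eq_sqrt_cinner:
  fixes x :: "'a::complex_inner"
  shows "complex_of_real (norm x) = csqrt (cinner x x)"
  by (simp add: cinner_self norm_eq_sqrt_inner csqrt_of_real_nonneg)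

instantiation complex :: complex_inner
begin

definition scaleC_complex :: "complex \<Rightarrow> complex \<Rightarrow> complex" where
  "scaleC_complex a x = a * x"

definition cinner_complex :: "complex \<Rightarrow> complex \<Rightarrow> complex" where
  "cinner_complex x y = x * cnj y"

instance
  by standard
    (auto simp: scaleC_complex_def cinner_complex_def inner_complex_def algebra_simps
      scaleR_conv_of_real)

end

text \<open>
  An operator in \<open>'h\<close> is a partial function \<open>'h \<rightharpoonup> 'h\<close>, so that equality of operators includes
  equality of domains. The domain is \<open>dom A\<close>, the range \<open>ran A\<close>, the identity \<open>Some\<close>, and the product
  with its natural domain is \<open>A \<circ>\<^sub>m B\<close>. The notions depending on the scalar multiplication or the
  inner product take it as an argument, which is \<open>scaleR\<close>, \<open>inner\<close> in the real case and
  \<open>scaleC\<close>, \<open>cinner\<close> in the complex case.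
\<close>

definition linear_operator :: "('k::comm_ring_1 \<Rightarrow> 'h \<Rightarrow> 'h) \<Rightarrow> ('h::ab_group_add \<rightharpoonup> 'h) \<Rightarrow> bool" where
  "linear_operator scl A \<longleftrightarrow>
     module.subspace scl (dom A) \<and>
     (\<forall>x\<in>dom A. \<forall>y\<in>dom A. the (A (x + y)) = the (A x) + the (A y)) \<and>
     (\<forall>c. \<forall>x\<in>dom A. the (A (scl c x)) = scl c (the (A x)))"

definition op_plus :: "('h::plus \<rightharpoonup> 'h) \<Rightarrow> ('h \<rightharpoonup> 'h) \<Rightarrow> ('h \<rightharpoonup> 'h)" where
  "op_plus A B =
     (\<lambda>x. if x \<in> dom A \<inter> dom B then Some (the (A x) + the (B x)) else None)"

definition densely_defined :: "('h::topological_space \<rightharpoonup> 'h) \<Rightarrow> bool" where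
  "densely_defined A \<longleftrightarrow> closure (dom A) = UNIV"

definition symmetric_operator :: "('h \<Rightarrow> 'h \<Rightarrow> 'k) \<Rightarrow> ('h \<rightharpoonup> 'h) \<Rightarrow> bool" where
  "symmetric_operator ip A \<longleftrightarrow>
     (\<forall>x\<in>dom A. \<forall>y\<in>dom A. ip (the (A x)) y = ip x (the (A y)))"

text \<open>The vector \<open>z\<close> below is unique, and hence the adjoint meaningful, only if \<open>dom A\<close> is dense.\<close>

definition adjoint_operator :: "('h \<Rightarrow> 'h \<Rightarrow> 'k) \<Rightarrow> ('h \<rightharpoonup> 'h) \<Rightarrow> ('h \<rightharpoonup> 'h)" where
  "adjoint_operator ip A =
     (\<lambda>y. if \<exists>z. \<forall>x\<in>dom A. ip (the (A x)) y = ip x z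
          then Some (THE z. \<forall>x\<in>dom A. ip (the (A x)) y = ip x z)
          else None)"

definition selfadjoint_operator ::
    "('h::topological_space \<Rightarrow> 'h \<Rightarrow> 'k) \<Rightarrow> ('h \<rightharpoonup> 'h) \<Rightarrow> bool" where
  "selfadjoint_operator ip A \<longleftrightarrow> densely_defined A \<and> A = adjoint_operator ip A"

text \<open>
  For \<open>'k = complex\<close>, the order is that of \<open>HOL-Library.Complex_Order\<close>, where \<open>0 \<le> z\<close> means that
  \<open>z\<close> is real and nonnegative.
\<close>

definition positive_operator :: "('h \<Rightarrow> 'h \<Rightarrow> 'k::{zero, ord}) \<Rightarrow> ('h \<rightharpoonup> 'h) \<Rightarrow> bool" where
  "positive_operator ip A \<longleftrightarrow>
     symmetric_operator ip A \<and> (\<forall>x\<in>dom A. 0 \<le> ip (the (A x)) x)"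

end

theory Submission
  imports Defs
begin

text \<open>
  If \<open>A\<close> is selfadjoint, its graph is closed, and the orthogonal projection \<open>(x, A x)\<close> of \<open>(h, 0)\<close>
  onto it satisfies \<open>x + A\<^sup>2 x = h\<close>. Conversely, if \<open>I + A\<^sup>2\<close> is onto, then
  \<open>((I + A\<^sup>2) u | u) = \<parallel>u\<parallel>\<^sup>2 + \<parallel>A u\<parallel>\<^sup>2\<close> shows that only \<open>0\<close> is orthogonal to \<open>dom A\<^sup>2\<close>, and solving
  \<open>x - A y = h\<close>, \<open>A x + y = k\<close> decomposes the product space into the graph of \<open>A\<close> and its rotation,
  which forces the adjoint to be \<open>A\<close>. Finally, a densely defined positive \<open>S\<close>, here \<open>A\<^sup>2\<close>, is
  selfadjoint iff \<open>I + S\<close> is onto, as \<open>\<parallel>(I + S) x\<parallel> \<ge> \<parallel>x\<parallel>\<close> makes the range closed. The complex case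
  reduces to the real one: on a complex subspace, the adjoints for \<open>cinner\<close> and for its real part
  agree.
\<close>

section \<open>Orthogonal projections and dense subspaces\<close>

text \<open>A sequence in \<open>S\<close> minimizing the distance to \<open>h\<close> is Cauchy,
  and its limit \<open>p\<close> attains the infimum, so moving \<open>p\<close> along
  \<open>S\<close> cannot lower the distance. As \<open>S\<close> need not be closed,
  \<open>p\<close> is only found in its closure.\<close>

lemma subspace_orthogonal_projection:
  fixes S :: "'a::{real_inner, complete_space} set"
  assumes S: "subspace S"
  obtains p where "p \<in> closure S" "\<And>v. v \<in> S \<Longrightarrow> inner (h - p) v = 0"
proof -
  define D where "D = (INF s\<in>S. (norm (s - h))\<^sup>2)"
  have "S \<noteq> {}" using S subspace_0 by blast
  have bdd: "bdd_below ((\<lambda>s. (norm (s - h))\<^sup>2) ` S)" by (rule bdd_belowI[of _ 0]) auto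
  have D_le: "D \<le> (norm (s - h))\<^sup>2" if "s \<in> S" for s
    unfolding D_def using that by (intro cINF_lower bdd)
  have "\<exists>s\<in>S. (norm (s - h))\<^sup>2 < D + inverse (real (Suc n))" for n
    using cINF_less_iff[OF \<open>S \<noteq> {}\<close> bdd, of "D + inverse (real (Suc n))"]
    by (simp add: D_def)
  then obtain s where s: "\<And>n. s n \<in> S" "\<And>n. (norm (s n - h))\<^sup>2 < D + inverse (real (Suc n))"
    by metis
  have near: "(norm (s m - s n))\<^sup>2 < 2 * inverse (real (Suc m)) + 2 * inverse (real (Suc n))" for m n
  proof -
    \<comment> \<open>Parallelogram law for \<open>s m - h\<close> and \<open>s n - h\<close>: the
      midpoint is in \<open>S\<close>, so its squared distance to \<open>h\<close> is at least
      \<open>D\<close>.\<close>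
    have "(1/2) *\<^sub>R (s m + s n) \<in> S"
      using s(1) S by (simp add: subspace_add subspace_scale)
    note D_le[OF this]
    moreover have "(norm (s m - s n))\<^sup>2 + 4 * (norm ((1/2) *\<^sub>R (s m + s n) - h))\<^sup>2
        = 2 * (norm (s m - h))\<^sup>2 + 2 * (norm (s n - h))\<^sup>2"
      by (simp add: power2_norm_eq_inner inner_diff_left inner_diff_right inner_add_left
          inner_add_right inner_commute algebra_simps)
    ultimately show ?thesis using s(2)[of m] s(2)[of n] by linarith
  qed
  have "Cauchy s"
  proof (rule metric_CauchyI)
    fix e :: real assume "0 < e"
    then obtain M where M: "inverse (real (Suc M)) < e\<^sup>2 / 4"
      using reals_Archimedean[of "e\<^sup>2 / 4"] by auto
    have "dist (s m) (s n) < e" if "M \<le> m" "M \<le> n" for m n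
    proof (rule power2_less_imp_less)
      have "inverse (real (Suc k)) \<le> inverse (real (Suc M))" if "M \<le> k" for k
        using that by (simp add: inverse_eq_divide frac_le)
      from this[of m] this[of n] show "(dist (s m) (s n))\<^sup>2 < e\<^sup>2"
        using near[of m n] M that unfolding dist_norm by linarith
    qed (use \<open>0 < e\<close> in simp)
    then show "\<exists>M. \<forall>m\<ge>M. \<forall>n\<ge>M. dist (s m) (s n) < e" by blast
  qed
  then obtain p where p: "s \<longlonglongrightarrow> p"
    using Cauchy_convergent_iff convergent_def by blast
  have "p \<in> closure S" using s(1) p closure_sequential by blast
  have "(\<lambda>n. D + inverse (real (Suc n))) \<longlonglongrightarrow> D + 0"
    by (intro tendsto_intros LIMSEQ_inverse_real_of_nat)
  moreover have "(\<lambda>n. (norm (s n - h))\<^sup>2) \<longlonglongrightarrow> (norm (p - h))\<^sup>2"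
    by (intro tendsto_intros p)
  ultimately have "(norm (p - h))\<^sup>2 \<le> D + 0"
    using s(2) less_imp_le by (intro LIMSEQ_le) blast+
  then have p_le: "(norm (p - h))\<^sup>2 \<le> D" by simp
  have "inner (h - p) v = 0" if "v \<in> S" for v
  proof (rule ccontr)
    assume nz: "inner (h - p) v \<noteq> 0"
    define c where "c = inner (h - p) v"
    \<comment> \<open>This \<open>t\<close> minimizes the quadratic
      \<open>(norm (p + t *\<^sub>R v - h))\<^sup>2\<close>.\<close>
    define t where "t = c / (norm v)\<^sup>2"
    have "v \<noteq> 0" using nz by auto
    \<comment> \<open>The point \<open>p + t *\<^sub>R v\<close> may lie outside \<open>S\<close>,
      so the bound by \<open>D\<close> is taken along the sequence and passed to the limit.\<close>
    have "D \<le> (norm (s n + t *\<^sub>R v - h))\<^sup>2" for n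
      using s(1) that S by (intro D_le subspace_add subspace_scale)
    moreover have "(\<lambda>n. (norm (s n + t *\<^sub>R v - h))\<^sup>2) \<longlonglongrightarrow> (norm (p + t *\<^sub>R v - h))\<^sup>2"
      by (intro tendsto_intros p)
    ultimately have "D \<le> (norm (p + t *\<^sub>R v - h))\<^sup>2"
      using LIMSEQ_le_const by blast
    then have "(norm (p - h))\<^sup>2 \<le> (norm (p + t *\<^sub>R v - h))\<^sup>2" using p_le by linarith
    also have "\<dots> = (norm (p - h))\<^sup>2 - 2 * t * c + t\<^sup>2 * (norm v)\<^sup>2"
      unfolding c_def power2_norm_eq_inner
      by (simp add: inner_diff_left inner_diff_right inner_add_left inner_add_right
          inner_commute algebra_simps power2_eq_square)
    also have "\<dots> = (norm (p - h))\<^sup>2 - c\<^sup>2 / (norm v)\<^sup>2"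
      using \<open>v \<noteq> 0\<close> by (simp add: t_def field_simps power2_eq_square)
    finally show False using nz \<open>v \<noteq> 0\<close> by (simp add: c_def divide_le_0_iff)
  qed
  with \<open>p \<in> closure S\<close> show thesis using that by blast
qed

lemma orthogonal_to_dense_eq_0:
  fixes S :: "'a::real_inner set"
  assumes "closure S = UNIV" "\<And>s. s \<in> S \<Longrightarrow> inner s z = 0"
  shows "z = 0"
proof -
  have "closed {s. inner s z = 0}" by (intro closed_Collect_eq continuous_intros)
  then have "closure S \<subseteq> {s. inner s z = 0}" using assms(2) by (intro closure_minimal) auto
  then have "z \<in> {s. inner s z = 0}" using assms(1) by blast
  then show ?thesis by simp
qed

text \<open>The residual \<open>h - p\<close> of the projection is orthogonal to \<open>S\<close>,
  hence zero, which puts \<open>h = p\<close> into the closure.\<close>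

lemma dense_subspaceI:
  fixes S :: "'a::{real_inner, complete_space} set"
  assumes "subspace S" "\<And>z. (\<And>s. s \<in> S \<Longrightarrow> inner z s = 0) \<Longrightarrow> z = 0"
  shows "closure S = UNIV"
proof -
  have "h \<in> closure S" for h
  proof -
    obtain p where "p \<in> closure S" "\<And>v. v \<in> S \<Longrightarrow> inner (h - p) v = 0"
      using assms(1) subspace_orthogonal_projection by metis
    then show ?thesis using assms(2)[of "h - p"] by auto
  qed
  then show ?thesis by blast
qed

section \<open>Linear operators as partial functions\<close>

context module
begin

text \<open>Rephrases linearity on the graph, free of \<open>the\<close>. Working in an arbitrary
  module serves real and complex scalars at once.\<close>

lemma linear_operator_iff:
  "linear_operator scale A \<longleftrightarrow>
     A 0 = Some 0 \<and>
     (\<forall>x y u v. A x = Some u \<longrightarrow> A y = Some v \<longrightarrow> A (x + y) = Some (u + v)) \<and>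
     (\<forall>c x u. A x = Some u \<longrightarrow> A (scale c x) = Some (scale c u))"
  (is "_ \<longleftrightarrow> ?R")
proof
  assume L: "linear_operator scale A"
  then have sub: "subspace (dom A)"
    and add: "\<And>x y. x \<in> dom A \<Longrightarrow> y \<in> dom A \<Longrightarrow> the (A (x + y)) = the (A x) + the (A y)"
    and scal: "\<And>c x. x \<in> dom A \<Longrightarrow> the (A (scale c x)) = scale c (the (A x))"
    by (auto simp: linear_operator_def)
  have "the (A 0) = 0" using scal[OF subspace_0[OF sub], of 0] by simp
  then have "A 0 = Some 0" using subspace_0[OF sub] by auto
  moreover have "A (x + y) = Some (u + v)" if "A x = Some u" "A y = Some v" for x y u v
    using subspace_add[OF sub, of x y] add[of x y] that by force
  moreover have "A (scale c x) = Some (scale c u)" if "A x = Some u" for c x u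
    using subspace_scale[OF sub, of x c] scal[of x c] that by force
  ultimately show ?R by blast
next
  assume ?R
  then show "linear_operator scale A"
    unfolding linear_operator_def by (intro conjI subspaceI ballI allI) force+
qed

lemma linear_operator_comp:
  assumes A: "linear_operator scale A" and B: "linear_operator scale B"
  shows "linear_operator scale (A \<circ>\<^sub>m B)"
  unfolding linear_operator_iff
proof (intro conjI allI impI)
  show "(A \<circ>\<^sub>m B) 0 = Some 0"
    using A B by (simp add: linear_operator_iff)
next
  fix x y u v assume "(A \<circ>\<^sub>m B) x = Some u" "(A \<circ>\<^sub>m B) y = Some v"
  then obtain x' y' where "B x = Some x'" "A x' = Some u" "B y = Some y'" "A y' = Some v"
    by (auto simp: map_comp_Some_iff)
  then show "(A \<circ>\<^sub>m B) (x + y) = Some (u + v)"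
    using A B by (simp add: linear_operator_iff)
next
  fix c x u assume "(A \<circ>\<^sub>m B) x = Some u"
  then obtain x' where "B x = Some x'" "A x' = Some u" by (auto simp: map_comp_Some_iff)
  then show "(A \<circ>\<^sub>m B) (scale c x) = Some (scale c u)"
    using A B by (simp add: linear_operator_iff)
qed

end

lemma linear_operator_scaleR_iff:
  fixes A :: "'a::real_vector \<rightharpoonup> 'a"
  shows "linear_operator scaleR A \<longleftrightarrow>
     A 0 = Some 0 \<and>
     (\<forall>x y u v. A x = Some u \<longrightarrow> A y = Some v \<longrightarrow> A (x + y) = Some (u + v)) \<and>
     (\<forall>c x u. A x = Some u \<longrightarrow> A (c *\<^sub>R x) = Some (c *\<^sub>R u))"
  by (rule real_vector.linear_operator_iff)

lemma subspace_dom_linear_operator: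
  "linear_operator scaleR A \<Longrightarrow> subspace (dom A)"
  unfolding linear_operator_def by (simp add: subspace_raw_def)

section \<open>Symmetric and positive operators\<close>

lemma symmetric_operatorD:
  assumes "symmetric_operator ip A" "A x = Some u" "A y = Some v"
  shows "ip u y = ip x v"
proof -
  have "ip (the (A x)) y = ip x (the (A y))"
    using assms unfolding symmetric_operator_def by blast
  then show ?thesis using assms by simp
qed

lemma positive_operatorD:
  assumes "positive_operator ip A" "A x = Some u"
  shows "0 \<le> ip u x"
proof -
  have "0 \<le> ip (the (A x)) x" using assms unfolding positive_operator_def by blast
  then show ?thesis using assms by simp
qed

text \<open>Symmetry is applied twice: (A^2 x | y) = (A x | A y) = (x | A^2 y).\<close>

lemma symmetric_operator_comp_self:
  assumes A: "symmetric_operator ip A"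
  shows "symmetric_operator ip (A \<circ>\<^sub>m A)"
  unfolding symmetric_operator_def
proof (intro ballI)
  fix x y assume "x \<in> dom (A \<circ>\<^sub>m A)" "y \<in> dom (A \<circ>\<^sub>m A)"
  then obtain u v u' v' where
    "A x = Some u" "A u = Some v" "A y = Some u'" "A u' = Some v'"
    by (auto simp: map_comp_Some_iff)
  then show "ip (the ((A \<circ>\<^sub>m A) x)) y = ip x (the ((A \<circ>\<^sub>m A) y))"
    using symmetric_operatorD[OF A, of u v y u'] symmetric_operatorD[OF A, of x u u' v'] by simp
qed

lemma positive_operator_comp_self:
  fixes A :: "'a::real_inner \<rightharpoonup> 'a"
  assumes "symmetric_operator inner A"
  shows "positive_operator inner (A \<circ>\<^sub>m A)"
proof -
  have "0 \<le> inner w x" if "A x = Some v" "A v = Some w" for x v w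
    using symmetric_operatorD[OF assms that(2,1)] by simp
  then show ?thesis
    using symmetric_operator_comp_self[OF assms] unfolding positive_operator_def
    by (auto simp: map_comp_Some_iff)
qed

section \<open>Selfadjointness in terms of graphs\<close>

text \<open>The left side has the shape of \<open>adjoint_operator\<close>, whose graph is thus
  given by \<open>P\<close> as soon as values are unique.\<close>

lemma if_ex_Some_The_eq_Some_iff:
  assumes "\<And>z z'. P z \<Longrightarrow> P z' \<Longrightarrow> z = z'"
  shows "(if \<exists>z. P z then Some (THE z. P z) else None) = Some z \<longleftrightarrow> P z"
proof (cases "\<exists>z. P z")
  case True
  then obtain w where w: "P w" by blast
  then have "(THE z. P z) = w" by (rule the_equality) (rule assms[OF _ w])
  moreover have "P z \<longleftrightarrow> w = z"
  proof
    show "w = z" if "P z" using assms w that .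
  qed (use w in simp)
  ultimately show ?thesis using True by simp
qed simp

lemma map_eq_iff_graph_eq: "m = m' \<longleftrightarrow> (\<forall>x y. m x = Some y \<longleftrightarrow> m' x = Some y)"
proof (intro iffI ext)
  fix x assume eq: "\<forall>x y. m x = Some y \<longleftrightarrow> m' x = Some y"
  show "m x = m' x"
  proof (cases "m' x")
    case None
    then have "\<not> (\<exists>y. m x = Some y)" using eq by simp
    then show ?thesis using None by simp
  next
    case (Some y)
    then have "m x = Some y" using eq by blast
    then show ?thesis using Some by simp
  qed
qed simp_all

lemma Ball_dom_iff: "(\<forall>x\<in>dom m. P x (the (m x))) \<longleftrightarrow> (\<forall>x u. m x = Some u \<longrightarrow> P x u)"
proof (intro iffI allI impI ballI)
  fix x u assume P: "\<forall>x\<in>dom m. P x (the (m x))" and u: "m x = Some u"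
  then have "P x (the (m x))" by blast
  then show "P x u" using u by simp
next
  fix x assume P: "\<forall>x u. m x = Some u \<longrightarrow> P x u" and "x \<in> dom m"
  then obtain u where u: "m x = Some u" by blast
  show "P x (the (m x))" using P[rule_format, OF u] u by simp
qed

text \<open>Two candidate values of the adjoint differ by a vector orthogonal to the domain, which
  is zero by density. The choice operator can then be eliminated, and all later arguments use this
  form.\<close>

lemma selfadjoint_operator_inner_iff:
  fixes A :: "'a::real_inner \<rightharpoonup> 'a"
  shows "selfadjoint_operator inner A \<longleftrightarrow>
    closure (dom A) = UNIV \<and>
    (\<forall>y z. A y = Some z \<longleftrightarrow> (\<forall>x u. A x = Some u \<longrightarrow> inner u y = inner x z))"
proof (cases "closure (dom A) = UNIV")
  case True
  have uniq: "z = z'"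
    if "\<forall>x\<in>dom A. inner (the (A x)) y = inner x z" "\<forall>x\<in>dom A. inner (the (A x)) y = inner x z'"
    for y z z'
    using orthogonal_to_dense_eq_0[OF True, of "z - z'"] that by (simp add: inner_diff_right)
  have adj: "adjoint_operator inner A y = Some z \<longleftrightarrow>
      (\<forall>x u. A x = Some u \<longrightarrow> inner u y = inner x z)" for y z
  proof -
    have "adjoint_operator inner A y = Some z \<longleftrightarrow>
        (\<forall>x\<in>dom A. inner (the (A x)) y = inner x z)"
      unfolding adjoint_operator_def by (rule if_ex_Some_The_eq_Some_iff) (rule uniq)
    then show ?thesis by (simp only: Ball_dom_iff[where P = "\<lambda>x u. inner u y = inner x z"])
  qed
  have "selfadjoint_operator inner A \<longleftrightarrow> A = adjoint_operator inner A"
    using True by (simp add: selfadjoint_operator_def densely_defined_def)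
  also have "\<dots> \<longleftrightarrow> (\<forall>y z. A y = Some z \<longleftrightarrow> adjoint_operator inner A y = Some z)"
    by (rule map_eq_iff_graph_eq)
  finally show ?thesis using True by (simp only: adj simp_thms)
qed (simp add: selfadjoint_operator_def densely_defined_def)

text \<open>The graph of the adjoint is cut out by equations continuous in the pair, one for each
  \<open>(x, u)\<close> in the graph of \<open>A\<close>.\<close>

lemma closed_graph_selfadjoint:
  fixes A :: "'a::real_inner \<rightharpoonup> 'a"
  assumes "selfadjoint_operator inner A"
  shows "closed {(y, z). A y = Some z}"
proof -
  have "{(y, z). A y = Some z} = {p. \<forall>x u. A x = Some u \<longrightarrow> inner u (fst p) = inner x (snd p)}"
    (is "_ = ?R")
  proof (rule set_eqI)
    fix p :: "'a \<times> 'a"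
    have "A (fst p) = Some (snd p) \<longleftrightarrow> p \<in> ?R"
      using assms unfolding selfadjoint_operator_inner_iff by blast
    then show "p \<in> {(y, z). A y = Some z} \<longleftrightarrow> p \<in> ?R" by (simp only: mem_Collect_eq case_prod_beta)
  qed
  also have "closed ?R"
    \<comment> \<open>The premise \<open>A x = Some u\<close> does not depend on \<open>p\<close>,
      so it is an open condition on \<open>p\<close>.\<close>
    by (intro closed_Collect_all closed_Collect_imp closed_Collect_eq open_Collect_const
        continuous_intros)
  finally show ?thesis .
qed

section \<open>Selfadjointness of A and the range of I + A^2\<close>

lemma ran_op_plus_Some_iff:
  "h \<in> ran (op_plus Some S) \<longleftrightarrow> (\<exists>x u. S x = Some u \<and> h = x + u)"
proof -
  have "op_plus Some S x = Some h \<longleftrightarrow> (\<exists>u. S x = Some u \<and> h = x + u)" for x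
    by (cases "S x") (auto simp: op_plus_def)
  then show ?thesis by (simp add: ran_def)
qed

lemma ran_op_plus_Some_eq_UNIV_iff:
  "ran (op_plus Some S) = UNIV \<longleftrightarrow> (\<forall>h. \<exists>x u. S x = Some u \<and> h = x + u)"
  by (auto simp: set_eq_iff ran_op_plus_Some_iff)

lemma selfadjoint_imp_full_range:
  fixes A :: "'a::{real_inner, complete_space} \<rightharpoonup> 'a"
  assumes "linear_operator scaleR A" "selfadjoint_operator inner A"
  shows "ran (op_plus Some (A \<circ>\<^sub>m A)) = UNIV"
  unfolding ran_op_plus_Some_eq_UNIV_iff
proof
  fix h
  let ?G = "{(y, z). A y = Some z}"
  have "subspace ?G"
    using assms(1) by (auto simp: linear_operator_scaleR_iff subspace_def zero_prod_def)
  then obtain p where p: "p \<in> ?G" "\<And>v. v \<in> ?G \<Longrightarrow> inner ((h, 0) - p) v = 0"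
    using subspace_orthogonal_projection closure_closed[OF closed_graph_selfadjoint[OF assms(2)]]
    by metis
  obtain x y where xy: "p = (x, y)" "A x = Some y" using p(1) by auto
  \<comment> \<open>Orthogonality of \<open>(h - x, - y)\<close> to the graph says that the adjoint
    maps \<open>y\<close> to \<open>h - x\<close>.\<close>
  have "inner v y = inner u (h - x)" if "A u = Some v" for u v
    using p(2)[of "(u, v)"] that by (simp add: xy inner_commute)
  then have "A y = Some (h - x)"
    using assms(2) unfolding selfadjoint_operator_inner_iff by blast
  then show "\<exists>x u. (A \<circ>\<^sub>m A) x = Some u \<and> h = x + u"
    using xy(2) by (intro exI[of _ x] exI[of _ "h - x"]) (simp add: map_comp_Some_iff)
qed

lemma full_range_imp_dense_dom_comp_self:
  fixes A :: "'a::{real_inner, complete_space} \<rightharpoonup> 'a"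
  assumes A: "linear_operator scaleR A" "symmetric_operator inner A"
    and ran: "ran (op_plus Some (A \<circ>\<^sub>m A)) = UNIV"
  shows "closure (dom (A \<circ>\<^sub>m A)) = UNIV"
proof (rule dense_subspaceI)
  show "subspace (dom (A \<circ>\<^sub>m A))"
    by (intro subspace_dom_linear_operator real_vector.linear_operator_comp A)
  fix z assume z: "\<And>s. s \<in> dom (A \<circ>\<^sub>m A) \<Longrightarrow> inner z s = 0"
  \<comment> \<open>The full range is applied to \<open>z\<close> itself; pairing \<open>z\<close>
    with \<open>u\<close>, an element of dom A^2, leaves a sum of two squares.\<close>
  obtain u w v where u: "A u = Some v" "A v = Some w" "z = u + w"
    using ran unfolding ran_op_plus_Some_eq_UNIV_iff map_comp_Some_iff by metis
  have "inner u u + inner v v = inner z u"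
    using symmetric_operatorD[OF A(2) u(2) u(1)] u(3) by (simp add: inner_add_left)
  also have "\<dots> = 0" using u by (intro z) (simp add: dom_def)
  finally have "u = 0" "v = 0" by (simp_all add: add_nonneg_eq_0_iff)
  then show "z = 0" using u A(1) by (simp add: linear_operator_scaleR_iff)
qed

lemma full_range_imp_selfadjoint:
  fixes A :: "'a::{real_inner, complete_space} \<rightharpoonup> 'a"
  assumes A: "linear_operator scaleR A" "symmetric_operator inner A"
    and ran: "ran (op_plus Some (A \<circ>\<^sub>m A)) = UNIV"
  shows "selfadjoint_operator inner A"
  unfolding selfadjoint_operator_inner_iff
proof (intro conjI allI iffI impI)
  have "dom (A \<circ>\<^sub>m A) \<subseteq> dom A" by (auto simp: map_comp_Some_iff)
  then show "closure (dom A) = UNIV"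
    using full_range_imp_dense_dom_comp_self[OF A ran] closure_mono by blast
next
  fix y z x u assume "A y = Some z" "A x = Some u"
  then show "inner u y = inner x z" using symmetric_operatorD[OF A(2)] by blast
next
  fix y z assume "\<forall>x u. A x = Some u \<longrightarrow> inner u y = inner x z"
  then have adj: "inner u y = inner x z" if "A x = Some u" for x u using that by blast
  have add: "A (x + x') = Some (u + u')" if "A x = Some u" "A x' = Some u'" for x x' u u'
    using A(1) that by (simp add: linear_operator_scaleR_iff)
  have neg: "A (- x) = Some (- u)" if "A x = Some u" for x u
    using A(1) that unfolding linear_operator_scaleR_iff by (metis scaleR_minus1_left)
  \<comment> \<open>With (I + A^2) a = y and (I + A^2) b = z, the vectors x0 = a + A b and y0 = b -
    A a solve x0 - A y0 = y and A x0 + y0 = z.\<close>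
  obtain a a1 a2 where a: "A a = Some a1" "A a1 = Some a2" "y = a + a2"
    using ran unfolding ran_op_plus_Some_eq_UNIV_iff map_comp_Some_iff by metis
  obtain b b1 b2 where b: "A b = Some b1" "A b1 = Some b2" "z = b + b2"
    using ran unfolding ran_op_plus_Some_eq_UNIV_iff map_comp_Some_iff by metis
  \<comment> \<open>\<open>(y, z) = (x0, A x0) + (- A y0, y0)\<close>, where \<open>(y, z)\<close> and \<open>(x0, A x0)\<close> are orthogonal to all
    vectors \<open>(- A x, x)\<close>; hence the second summand is orthogonal to itself.\<close>
  define x0 where "x0 = a + b1"
  define y0 where "y0 = b + - a1"
  have x0: "A x0 = Some (a1 + b2)" unfolding x0_def by (intro add a b)
  have y0: "A y0 = Some (b1 + - a2)" unfolding y0_def by (intro add neg a b)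
  have "inner (b1 + - a2) (y - x0) = inner y0 (z - (a1 + b2))"
    using adj[OF y0] symmetric_operatorD[OF A(2) y0 x0] by (simp add: inner_diff_right)
  moreover have "y - x0 = - (b1 + - a2)" "z - (a1 + b2) = y0"
    using a(3) b(3) by (auto simp: x0_def y0_def)
  ultimately have "inner (b1 + - a2) (b1 + - a2) + inner y0 y0 = 0"
    by (simp only: inner_minus_right)
  then have "y0 = 0" "b1 + - a2 = 0"
    by (simp_all only: add_nonneg_eq_0_iff inner_ge_zero inner_eq_zero_iff)
  then have "y = x0" "z = a1 + b2"
    using \<open>y - x0 = - (b1 + - a2)\<close> \<open>z - (a1 + b2) = y0\<close> by auto
  then show "A y = Some z" using x0 by simp
qed

section \<open>Selfadjointness of S and the range of I + S\<close>

text \<open>If the adjoint maps \<open>y\<close> to \<open>z\<close>, choose \<open>u\<close> with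
  (I + S) u = y + z. Then \<open>y - u\<close> is orthogonal to the range of I + S, to which it
  belongs, so \<open>y = u\<close>.\<close>

lemma symmetric_full_range_imp_selfadjoint:
  fixes S :: "'a::real_inner \<rightharpoonup> 'a"
  assumes S: "closure (dom S) = UNIV" "symmetric_operator inner S"
    and ran: "ran (op_plus Some S) = UNIV"
  shows "selfadjoint_operator inner S"
  unfolding selfadjoint_operator_inner_iff
proof (intro conjI allI iffI impI)
  fix y z x u assume "S y = Some z" "S x = Some u"
  then show "inner u y = inner x z" using symmetric_operatorD[OF S(2)] by blast
next
  fix y z assume adj: "\<forall>x u. S x = Some u \<longrightarrow> inner u y = inner x z"
  obtain u v where u: "S u = Some v" "y + z = u + v"
    using ran unfolding ran_op_plus_Some_eq_UNIV_iff by metis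
  obtain x w where x: "S x = Some w" "y - u = x + w"
    using ran unfolding ran_op_plus_Some_eq_UNIV_iff by metis
  have "inner (x + w) y = inner x (y + z)"
    using adj x(1) by (simp add: inner_add_left inner_add_right)
  also have "\<dots> = inner (x + w) u"
    using symmetric_operatorD[OF S(2) x(1) u(1)] by (simp add: inner_add_left inner_add_right u(2))
  finally have "inner (y - u) (y - u) = 0" by (simp flip: x(2) add: inner_diff_right)
  then have "y = u" by simp
  then show "S y = Some z" using u by simp
qed (rule S(1))

text \<open>Preimages of a convergent sequence under I + S are again Cauchy, and the closed graph of
  \<open>S\<close> makes their limit a preimage of the limit.\<close>

lemma closed_range_positive_selfadjoint:
  fixes S :: "'a::{real_inner, complete_space} \<rightharpoonup> 'a"
  assumes S: "linear_operator scaleR S" "positive_operator inner S" "selfadjoint_operator inner S"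
  shows "closed (ran (op_plus Some S))"
  unfolding closed_sequential_limits
proof (intro allI impI, elim conjE)
  fix f w assume "\<forall>n. f n \<in> ran (op_plus Some S)" and f: "f \<longlonglongrightarrow> w"
  then have "\<exists>x u. S x = Some u \<and> f n = x + u" for n
    by (simp add: ran_op_plus_Some_iff)
  then obtain x u where x: "\<And>n. S (x n) = Some (u n)" "\<And>n. f n = x n + u n" by metis
  \<comment> \<open>Positivity at \<open>x m - x n\<close> and Cauchy-Schwarz give the estimate
    multiplied by \<open>norm (x m - x n)\<close>; cancelling this factor requires it to be
    nonzero.\<close>
  have le: "dist (x m) (x n) \<le> dist (f m) (f n)" for m n
  proof (cases "x m = x n")
    case False
    have "S (x m + (-1) *\<^sub>R x n) = Some (u m + (-1) *\<^sub>R u n)"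
      using S(1) x(1) unfolding linear_operator_scaleR_iff by blast
    then have "S (x m - x n) = Some (u m - u n)" by simp
    then have "0 \<le> inner (u m - u n) (x m - x n)" by (rule positive_operatorD[OF S(2)])
    then have "(norm (x m - x n))\<^sup>2 \<le> inner (f m - f n) (x m - x n)"
      by (simp add: power2_norm_eq_inner inner_add_left inner_diff_left x(2))
    also have "\<dots> \<le> norm (f m - f n) * norm (x m - x n)" by (rule norm_cauchy_schwarz)
    finally show ?thesis using False by (simp add: dist_norm power2_eq_square)
  qed simp
  have "Cauchy x"
  proof (rule metric_CauchyI)
    fix e :: real assume "0 < e"
    then obtain M where "\<And>m n. M \<le> m \<Longrightarrow> M \<le> n \<Longrightarrow> dist (f m) (f n) < e"
      using metric_CauchyD[OF LIMSEQ_imp_Cauchy[OF f]] by blast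
    then show "\<exists>M. \<forall>m\<ge>M. \<forall>n\<ge>M. dist (x m) (x n) < e"
      using le order_le_less_trans by blast
  qed
  then obtain a where a: "x \<longlonglongrightarrow> a" using Cauchy_convergent_iff convergent_def by blast
  have "(\<lambda>n. f n - x n) \<longlonglongrightarrow> w - a" by (intro tendsto_intros f a)
  then have "(\<lambda>n. (x n, u n)) \<longlonglongrightarrow> (a, w - a)"
    by (intro tendsto_Pair a) (simp add: x(2))
  then have "(a, w - a) \<in> {(y, z). S y = Some z}"
    by (rule closed_sequentially[OF closed_graph_selfadjoint[OF S(3)], rotated]) (simp add: x(1))
  then have "S a = Some (w - a)" "w = a + (w - a)" by simp_all
  then show "w \<in> ran (op_plus Some S)" unfolding ran_op_plus_Some_iff by blast
qed

text \<open>The range is closed, so density suffices. A vector \<open>z\<close> orthogonal to it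
  satisfies S z = - z by selfadjointness, and positivity then forces \<open>z = 0\<close>.\<close>

lemma positive_selfadjoint_imp_full_range:
  fixes S :: "'a::{real_inner, complete_space} \<rightharpoonup> 'a"
  assumes S: "linear_operator scaleR S" "positive_operator inner S" "selfadjoint_operator inner S"
  shows "ran (op_plus Some S) = UNIV"
proof -
  let ?R = "ran (op_plus Some S)"
  note R = ran_op_plus_Some_iff[of _ S]
  have "subspace ?R"
  proof (rule subspaceI)
    show "0 \<in> ?R" using S(1) unfolding R by (force simp: linear_operator_scaleR_iff)
    show "g + h \<in> ?R" if gh: "g \<in> ?R" "h \<in> ?R" for g h
    proof -
      obtain x u y v where "S x = Some u" "g = x + u" "S y = Some v" "h = y + v"
        using gh unfolding R by blast
      then have "S (x + y) = Some (u + v)" "g + h = (x + y) + (u + v)"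
        using S(1) by (auto simp: linear_operator_scaleR_iff)
      then show ?thesis unfolding R by blast
    qed
    show "c *\<^sub>R h \<in> ?R" if h: "h \<in> ?R" for c h
    proof -
      obtain x u where "S x = Some u" "h = x + u" using h unfolding R by blast
      then have "S (c *\<^sub>R x) = Some (c *\<^sub>R u)" "c *\<^sub>R h = c *\<^sub>R x + c *\<^sub>R u"
        using S(1) by (auto simp: linear_operator_scaleR_iff scaleR_right_distrib)
      then show ?thesis unfolding R by blast
    qed
  qed
  then have "closure ?R = UNIV"
  proof (rule dense_subspaceI)
    fix z assume z: "\<And>s. s \<in> ?R \<Longrightarrow> inner z s = 0"
    have "inner u z = inner x (- z)" if "S x = Some u" for x u
    proof -
      have "inner z (x + u) = 0" using that by (intro z) (auto simp: R)
      then show ?thesis by (simp add: inner_add_right inner_commute)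
    qed
    then have "S z = Some (- z)" using S(3) unfolding selfadjoint_operator_inner_iff by blast
    then have "0 \<le> inner (- z) z" by (rule positive_operatorD[OF S(2)])
    then have "inner z z \<le> 0" by simp
    then show "z = 0" using inner_gt_zero_iff[of z] by linarith
  qed
  then show ?thesis using closed_range_positive_selfadjoint[OF S] by (simp add: closure_closed)
qed

text \<open>The real case, with the range condition as the common term of comparison. Positivity of
  A^2 comes from \<open>positive_operator_comp_self\<close>.\<close>

proposition symmetric_operator_selfadjoint_equivalences:
  fixes A :: "'a::{real_inner, complete_space} \<rightharpoonup> 'a"
  assumes A: "linear_operator scaleR A" "symmetric_operator inner A"
  shows "selfadjoint_operator inner A \<longleftrightarrow> ran (op_plus Some (A \<circ>\<^sub>m A)) = UNIV"
    and "selfadjoint_operator inner (A \<circ>\<^sub>m A) \<longleftrightarrow> ran (op_plus Some (A \<circ>\<^sub>m A)) = UNIV"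
proof -
  show "selfadjoint_operator inner A \<longleftrightarrow> ran (op_plus Some (A \<circ>\<^sub>m A)) = UNIV"
    using selfadjoint_imp_full_range[OF A(1)] full_range_imp_selfadjoint[OF A] by (rule iffI)
  show "selfadjoint_operator inner (A \<circ>\<^sub>m A) \<longleftrightarrow> ran (op_plus Some (A \<circ>\<^sub>m A)) = UNIV"
  proof
    assume "selfadjoint_operator inner (A \<circ>\<^sub>m A)"
    then show "ran (op_plus Some (A \<circ>\<^sub>m A)) = UNIV"
      by (intro positive_selfadjoint_imp_full_range real_vector.linear_operator_comp
          positive_operator_comp_self A)
  next
    assume ran: "ran (op_plus Some (A \<circ>\<^sub>m A)) = UNIV"
    show "selfadjoint_operator inner (A \<circ>\<^sub>m A)"
      using full_range_imp_dense_dom_comp_self[OF A ran] symmetric_operator_comp_self[OF A(2)] ran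
      by (rule symmetric_full_range_imp_selfadjoint)
  qed
qed

section \<open>Reduction of the complex case to the real one\<close>

interpretation complex_inner: module "scaleC :: complex \<Rightarrow> 'a \<Rightarrow> 'a::complex_inner"
  by standard (simp_all add: scaleC_add_right scaleC_add_left scaleC_scaleC scaleC_one)

lemma linear_operator_scaleC_imp_scaleR:
  "linear_operator scaleC B \<Longrightarrow> linear_operator scaleR B"
  unfolding complex_inner.linear_operator_iff linear_operator_scaleR_iff scaleR_scaleC by blast

lemma cinner_eq_iff_inner_eq:
  fixes B :: "'a::complex_inner \<rightharpoonup> 'a"
  assumes "linear_operator scaleC B"
  shows "(\<forall>x\<in>dom B. cinner (the (B x)) y = cinner x z) \<longleftrightarrow>
    (\<forall>x\<in>dom B. inner (the (B x)) y = inner x z)"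
proof (intro iffI ballI)
  fix x assume inner: "\<forall>x\<in>dom B. inner (the (B x)) y = inner x z" and "x \<in> dom B"
  then obtain u where u: "B x = Some u" by blast
  \<comment> \<open>Since Re (i c) = - Im c, the real identity at i x is the equality of imaginary
    parts at x.\<close>
  then have iu: "B (scaleC \<i> x) = Some (scaleC \<i> u)"
    using assms by (simp add: complex_inner.linear_operator_iff)
  have "inner u y = inner x z" "inner (scaleC \<i> u) y = inner (scaleC \<i> x) z"
    using inner u iu by force+
  then show "cinner (the (B x)) y = cinner x z"
    using u by (simp add: inner_eq_Re_cinner cinner_scaleC_left complex_eq_iff)
qed (simp add: inner_eq_Re_cinner)

text \<open>Both forms impose the same condition on each pair \<open>(y, z)\<close>, so the adjoints
  coincide, while density depends on the topology alone.\<close>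

lemma selfadjoint_operator_cinner_iff:
  "linear_operator scaleC B \<Longrightarrow> selfadjoint_operator cinner B \<longleftrightarrow> selfadjoint_operator inner B"
  by (simp add: selfadjoint_operator_def adjoint_operator_def cinner_eq_iff_inner_eq cong: if_cong)

lemma symmetric_operator_cinner_imp_inner:
  "symmetric_operator cinner B \<Longrightarrow> symmetric_operator inner B"
  by (simp add: symmetric_operator_def inner_eq_Re_cinner)

text \<open>The order on \<open>complex\<close> also demands a zero imaginary part, which
  \<open>cinner_self\<close> provides for (B x | B x) = (B^2 x | x).\<close>

lemma positive_operator_cinner_comp_self:
  fixes B :: "'a::complex_inner \<rightharpoonup> 'a"
  assumes "symmetric_operator cinner B"
  shows "positive_operator cinner (B \<circ>\<^sub>m B)"
proof -
  have "0 \<le> cinner w x" if "B x = Some v" "B v = Some w" for x v w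
    using symmetric_operatorD[OF assms that(2,1)] by (simp add: cinner_self less_eq_complex_def)
  then show ?thesis
    using symmetric_operator_comp_self[OF assms] unfolding positive_operator_def
    by (auto simp: map_comp_Some_iff)
qed

theorem theorem2p2:
  fixes A :: "'r::{real_inner, complete_space} \<rightharpoonup> 'r"
    and B :: "'c::{complex_inner, complete_space} \<rightharpoonup> 'c"
  shows
    "(linear_operator scaleR A \<and> symmetric_operator inner A \<longrightarrow>
       ((densely_defined A \<and> selfadjoint_operator inner A) \<longleftrightarrow>
        (positive_operator inner (A \<circ>\<^sub>m A) \<and> selfadjoint_operator inner (A \<circ>\<^sub>m A))) \<and>
       ((positive_operator inner (A \<circ>\<^sub>m A) \<and> selfadjoint_operator inner (A \<circ>\<^sub>m A)) \<longleftrightarrow>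
        ran (op_plus Some (A \<circ>\<^sub>m A)) = UNIV)) \<and>
     (linear_operator scaleC B \<and> symmetric_operator cinner B \<longrightarrow>
       ((densely_defined B \<and> selfadjoint_operator cinner B) \<longleftrightarrow>
        (positive_operator cinner (B \<circ>\<^sub>m B) \<and> selfadjoint_operator cinner (B \<circ>\<^sub>m B))) \<and>
       ((positive_operator cinner (B \<circ>\<^sub>m B) \<and> selfadjoint_operator cinner (B \<circ>\<^sub>m B)) \<longleftrightarrow>
        ran (op_plus Some (B \<circ>\<^sub>m B)) = UNIV))"
\<comment> \<open>The instantiation splits only the outer conjunction of implications and keeps each
  pair of equivalences together.\<close>
proof (intro conjI[of "_ \<longrightarrow> _"] impI; elim conjE)
  assume A: "linear_operator scaleR A" "symmetric_operator inner A"
  have "densely_defined A \<and> selfadjoint_operator inner A \<longleftrightarrow> selfadjoint_operator inner A"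
    by (auto simp: selfadjoint_operator_def)
  then show "((densely_defined A \<and> selfadjoint_operator inner A) \<longleftrightarrow>
        (positive_operator inner (A \<circ>\<^sub>m A) \<and> selfadjoint_operator inner (A \<circ>\<^sub>m A))) \<and>
       ((positive_operator inner (A \<circ>\<^sub>m A) \<and> selfadjoint_operator inner (A \<circ>\<^sub>m A)) \<longleftrightarrow>
        ran (op_plus Some (A \<circ>\<^sub>m A)) = UNIV)"
    by (simp add: symmetric_operator_selfadjoint_equivalences[OF A] positive_operator_comp_self[OF A(2)])
next
  assume B: "linear_operator scaleC B" "symmetric_operator cinner B"
  have "densely_defined B \<and> selfadjoint_operator cinner B \<longleftrightarrow> selfadjoint_operator inner B"
    using selfadjoint_operator_cinner_iff[OF B(1)] by (auto simp: selfadjoint_operator_def)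
  then show "((densely_defined B \<and> selfadjoint_operator cinner B) \<longleftrightarrow>
        (positive_operator cinner (B \<circ>\<^sub>m B) \<and> selfadjoint_operator cinner (B \<circ>\<^sub>m B))) \<and>
       ((positive_operator cinner (B \<circ>\<^sub>m B) \<and> selfadjoint_operator cinner (B \<circ>\<^sub>m B)) \<longleftrightarrow>
        ran (op_plus Some (B \<circ>\<^sub>m B)) = UNIV)"
    using symmetric_operator_selfadjoint_equivalences
      [OF linear_operator_scaleC_imp_scaleR[OF B(1)] symmetric_operator_cinner_imp_inner[OF B(2)]]
    by (simp add: positive_operator_cinner_comp_self[OF B(2)]
        selfadjoint_operator_cinner_iff[OF complex_inner.linear_operator_comp[OF B(1) B(1)]])
qed

end
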